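(* Fix $L\ge 0$ and a set $\tilde\Omega$ with $\Omega^L\subseteq\tilde\Omega\subseteq C([0,T],H)$. Let $u$ be a minimax $L$-subsolution and let $v$ be a minimax $L$-supersolution of (TVP) on $[0,T]\times\tilde\Omega$. Then $w$ defined by $w(t,x,y):=u(t,x)-v(t,y)$ is a viscosity $L$-subsolution of the doubled equation $$\partial_t w(t,x,y)-\langle A(t,x(t)),\partial_x w(t,x,y)\rangle-\langle A(t,y(t)),\partial_y w(t,x,y)\rangle+F(t,x,\partial_x w(t,x,y))-F(t,y,-\partial_y w(t,x,y))=0$$ on $[0,T]\times\tilde\Omega\times\tilde\Omega$.
   Context: Spaces. Let $T>0$. $H$ is a real Hilbert space with inner product $(\cdot,\cdot)$ and norm $|\cdot|$; $V$ is a separable reflexive Banach space with norm $\|\cdot\|$, continuously, densely and compactly embedded into $H$; $V^\ast$ is its dual with norm $\|\cdot\|_\ast$ and duality pairing $\langle x^\ast,x\rangle=x^\ast(x)$. With the usual identifications, $V\subseteq H\subseteq V^\ast$ and $\langle x,y\rangle=(x,y)$ for $x\in H$, $y\in V$. Fix $p\ge 2$, $q>1$ with $1/p+1/q=1$. For $t_0\in[0,T)$, $W_{pq}(t_0,T)$ is the space of all $\mathbf{x}\in L^p(t_0,T;V)$ possessing a generalized derivative $\mathbf{x}'\in L^q(t_0,T;V^\ast)$. Operator. $A:[0,T]\times V\to V^\ast$ is fixed and satisfies: (i) $t\mapsto\langle A(t,x),v\rangle$ is measurable for all $x,v\in V$; (ii) for a.e. $t$ and all $x,y\in V$, $\langle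 A(t,x)-A(t,y),x-y\rangle\ge 0$; (iii) for a.e. $t$ and all $x,y,v\in V$, $s\mapsto\langle A(t,x+sy),v\rangle$ is continuous on $[0,1]$; (iv) there are $a_1\in L^q(0,T)$, $c_1\ge0$ with $\|A(t,x)\|_\ast\le a_1(t)+c_1\|x\|^{p-1}$ for all $x\in V$ and a.e. $t$; (v) there is $c_2>0$ with $\langle A(t,x),x\rangle\ge c_2\|x\|^p$ for all $x\in V$ and a.e. $t$. Paths and continuity. $C([0,T],H)$ carries the sup norm. On $[0,T]\times C([0,T],H)$ and its subsets use the pseudo-metric $\mathbf{d}_\infty((t,x),(s,y))=|t-s|+\sup_{r\in[0,T]}|x(r\wedge t)-y(r\wedge s)|$, and on $[0,T]\times C([0,T],H)^2$ the analogous pseudo-metric with the pair of stopped paths; (semi-)continuity in $(t,x)$ or $(t,x,y)$ is meant with respect to these (so such functions are non-anticipating, i.e. their value at time $t$ depends only on the paths up to time $t$). USC and LSC denote real-valued upper and lower semicontinuous functions. Trajectories. For $L\ge 0$ and $(t_0,x_0)\in[0,T)\times C([0,T],H)$, $\mathcal{X}^L(t_0,x_0)$ is the set of all $x\in C([0,T],H)$ with $x=x_0$ on $[0,t_0]$ for which there exist $\mathbf{x}\in W_{pq}(t_0,T)$ and $f^x\in L^2(t_0,T;H)$ with $x=\mathbf{x}$ a.e. on $(t_0,T)$, $\mathbf{x}'(t)+A(t,\mathbf{x}(t))=f^x(t)$ a.e. on $(t_0,T)$, and $|f^x(t)|\le L(1+\sup_{0\le s\le t}|x(s)|)$ a.e.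 on $(t_0,T)$ ($\mathbf{x}$, $f^x$ are uniquely determined by $x$). Fix $x_\ast\in H$, regarded as a constant path, and put $\Omega^L:=\mathcal{X}^L(0,x_\ast)$. Data. $h:C([0,T],H)\to\mathbb{R}$ is continuous. $F:[0,T]\times C([0,T],H)\times H\to\mathbb{R}$ satisfies: (i) $F$ is continuous; (ii) there is $L_0\ge0$ with $|F(t,x,z)-F(t,x,\tilde z)|\le L_0(1+\sup_{0\le s\le t}|x(s)|)|z-\tilde z|$ for all $t,x,z,\tilde z$; (iii) for every $L\ge0$ and $(t_0,x_0)\in[0,T)\times C([0,T],H)$ there is a modulus of continuity $m_{L,t_0,x_0}$ such that for all $\varepsilon>0$, $t\in[t_0,T]$, $x,y\in\mathcal{X}^L(t_0,x_0)$: $F(t,x,\varepsilon^{-1}[x(t)-y(t)])-F(t,y,\varepsilon^{-1}[x(t)-y(t)])\le m_{L,t_0,x_0}(\varepsilon^{-1}|x(t)-y(t)|^2+\sup_{s\le t}|x(s)-y(s)|)$. (TVP) denotes the terminal-value problem $\partial_tu-\langle A(t,x(t)),\partial_xu\rangle+F(t,x,\partial_xu)=0$ on $[0,T)\times C([0,T],H)$, $u(T,x)=h(x)$. Minimax semisolutions. $u:[0,T]\times\tilde\Omega\to\mathbb{R}$ is a minimax $L$-subsolution (resp. $L$-supersolution) of (TVP) on $[0,T]\times\tilde\Omega$ if $u\in\mathrm{USC}([0,T]\times\tilde\Omega)$ (resp. $\mathrm{LSC}$), $u(T,\cdot)\le h$ (resp. $\ge h$) on $\tilde\Omega$, and for every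 $(t_0,x_0,z)\in[0,T)\times\tilde\Omega\times H$ there is $x\in\mathcal{X}^L(t_0,x_0)\cap\tilde\Omega$ such that for every $t\in[t_0,T]$: $u(t_0,x_0)\le$ (resp. $\ge$) $\int_{t_0}^t[(-f^x(s),z)+F(s,x,z)]\,ds+u(t,x)$. Test functions. For $t_\ast\in[0,T)$, $\mathcal{C}^{1,1}_V([t_\ast,T]\times C([0,T],H)^2)$ is the set of continuous $\varphi:[t_\ast,T]\times C([0,T],H)^2\to\mathbb{R}$ for which there exist continuous functions (path derivatives) $\partial_t\varphi$ (real-valued) and $\partial_x\varphi,\partial_y\varphi$ ($H$-valued) on the same domain such that: (a) for every pair $(x,y)$, $x(t)\in V$ implies $\partial_x\varphi(t,x,y)\in V$, and $y(t)\in V$ implies $\partial_y\varphi(t,x,y)\in V$, for a.e. $t\in(t_\ast,T)$; (b) for every $t_0\in[t_\ast,T)$, $x_0,y_0,x,y\in C([0,T],H)$ and $\mathbf{x},\mathbf{y}\in W_{pq}(t_0,T)$ with $x=x_0$, $y=y_0$ on $[0,t_0]$ and $x=\mathbf{x}$, $y=\mathbf{y}$ a.e. on $(t_0,T)$, and every $t\in[t_0,T]$, $\varphi(t,x,y)-\varphi(t_0,x_0,y_0)=\int_{t_0}^t\partial_t\varphi(s,x,y)+\langle\mathbf{x}'(s),\partial_x\varphi(s,x,y)\rangle+\langle\mathbf{y}'(s),\partial_y\varphi(s,x,y)\rangle\,ds$. Viscosity subsolution. For a non-anticipating $w:[0,T]\times\tilde\Omega\times\tilde\Omega\to\mathbb{R}$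 and $(t_0,x_0,y_0)\in[0,T)\times\tilde\Omega\times\tilde\Omega$, let $\underline{\mathcal{A}}^Lw(t_0,x_0,y_0)$ be the set of $\varphi\in\mathcal{C}^{1,1}_V([t_0,T]\times C([0,T],H)^2)$ for which there is $T_0\in(t_0,T]$ with $0=(\varphi-w)(t_0,x_0,y_0)=\inf(\varphi-w)$, the infimum being over $(t,x,y)\in[t_0,T_0]\times\mathcal{X}^L(t_0,x_0)\times\mathcal{X}^L(t_0,y_0)$. A function $w\in\mathrm{USC}([0,T]\times\tilde\Omega\times\tilde\Omega)$ is a viscosity $L$-subsolution of the doubled equation on $[0,T]\times\tilde\Omega\times\tilde\Omega$ if for every $(t_0,x_0,y_0)\in[0,T)\times\tilde\Omega\times\tilde\Omega$ and every $\varphi\in\underline{\mathcal{A}}^Lw(t_0,x_0,y_0)$ there is $(x,y)\in\mathcal{X}^L(t_0,x_0)\times\mathcal{X}^L(t_0,y_0)$ with $$\partial_t\varphi(t_0,x_0,y_0)+\limsup_{\delta\downarrow0}\frac1\delta\int_{t_0}^{t_0+\delta}\left[-\langle A(t,\mathbf{x}(t)),\partial_x\varphi(t,x,y)\rangle-\langle A(t,\mathbf{y}(t)),\partial_y\varphi(t,x,y)\rangle\right]dt+F(t_0,x_0,\partial_x\varphi(t_0,x_0,y_0))-F(t_0,y_0,-\partial_y\varphi(t_0,x_0,y_0))\ge0.$$ *)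

theory Defs
  imports "HOL-Analysis.Analysis"
begin

definition continuous_wrt ::
    "('a \<Rightarrow> 'a \<Rightarrow> real) \<Rightarrow> 'a set \<Rightarrow> ('a \<Rightarrow> 'b::metric_space) \<Rightarrow> bool" where
  "continuous_wrt d S f \<longleftrightarrow>
     (\<forall>a\<in>S. \<forall>e>0. \<exists>\<delta>>0. \<forall>b\<in>S. d a b < \<delta> \<longrightarrow> dist (f b) (f a) < e)"

definition usc_wrt :: "('a \<Rightarrow> 'a \<Rightarrow> real) \<Rightarrow> 'a set \<Rightarrow> ('a \<Rightarrow> real) \<Rightarrow> bool" where
  "usc_wrt d S f \<longleftrightarrow> (\<forall>a\<in>S. \<forall>e>0. \<exists>\<delta>>0. \<forall>b\<in>S. d a b < \<delta> \<longrightarrow> f b < f a + e)"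

definition lsc_wrt :: "('a \<Rightarrow> 'a \<Rightarrow> real) \<Rightarrow> 'a set \<Rightarrow> ('a \<Rightarrow> real) \<Rightarrow> bool" where
  "lsc_wrt d S f \<longleftrightarrow> (\<forall>a\<in>S. \<forall>e>0. \<exists>\<delta>>0. \<forall>b\<in>S. d a b < \<delta> \<longrightarrow> f a - e < f b)"

definition modulus_of_continuity :: "(real \<Rightarrow> real) \<Rightarrow> bool" where
  "modulus_of_continuity m \<longleftrightarrow> mono_on {0..} m \<and> m 0 = 0 \<and> (m \<longlongrightarrow> 0) (at_right 0)"

text \<open>
  The space \<open>L\<^sup>r(a,b;E)\<close>, as a set of representatives. It is only used for separable \<open>E\<close>
  (\<open>V\<close>, \<open>H\<close>, the real line, and the dual of the separable reflexive space \<open>V\<close>), where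
  Borel measurability is the same as strong measurability.
\<close>

definition Lp :: "real \<Rightarrow> real \<Rightarrow> real \<Rightarrow> (real \<Rightarrow> 'e::real_normed_vector) set" where
  "Lp r a b = {f. f \<in> borel_measurable (lebesgue_on {a<..<b}) \<and>
                  integrable (lebesgue_on {a<..<b}) (\<lambda>t. norm (f t) powr r)}"

definition smooth_compact_support :: "real \<Rightarrow> real \<Rightarrow> (real \<Rightarrow> real) set" where
  "smooth_compact_support a b =
     {\<eta>. (\<forall>n t. ((deriv ^^ n) \<eta>) field_differentiable (at t)) \<and>
         closure {t. \<eta> t \<noteq> 0} \<subseteq> {a<..<b}}"

text \<open>
  \<open>V\<close> is the type \<open>'v\<close>, whose class \<open>second_countable_topology\<close> expresses separability, and its
  inclusion into \<open>H\<close> is the injection \<open>j\<close>, so that an element \<open>y\<close> of \<open>H\<close> lies in \<open>V\<close> iff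
  \<open>y \<in> range j\<close>, and is then the element \<open>inv j y\<close> of \<open>V\<close>. The dual of \<open>V\<close> is
  \<open>'v \<Rightarrow>\<^sub>L real\<close> with the operator norm. Separability of \<open>H\<close> is no extra assumption, as \<open>V\<close> is
  separable and dense in \<open>H\<close>; having it as a class makes the library's
  integration theory available for \<open>H\<close>-valued functions.
\<close>

locale evolution_setting =
  fixes T p q :: real
    and j :: "'v::{banach, second_countable_topology} \<Rightarrow>\<^sub>L
              'h::{real_inner, banach, second_countable_topology}"
    and A :: "real \<Rightarrow> 'v \<Rightarrow> ('v \<Rightarrow>\<^sub>L real)"
  assumes T_pos: "0 < T"
    and p_ge_2: "2 \<le> p"
    and q_gt_1: "1 < q"
    and conjugate_exponents: "1 / p + 1 / q = 1"
    and reflexive: "\<And>l :: ('v \<Rightarrow>\<^sub>L real) \<Rightarrow>\<^sub>L real. \<exists>v. \<forall>f. blinfun_apply l f = blinfun_apply f v"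
    and inj_embedding: "inj (blinfun_apply j)"
    and dense_embedding: "closure (range (blinfun_apply j)) = UNIV"
    and compact_embedding: "compact (closure (blinfun_apply j ` cball 0 1))"
    and A_measurable: "\<And>x v. (\<lambda>t. A t x v) \<in> borel_measurable (lebesgue_on {0..T})"
    and A_monotone: "AE t in lebesgue_on {0..T}. \<forall>x y. 0 \<le> (A t x - A t y) (x - y)"
    and A_hemicontinuous:
      "AE t in lebesgue_on {0..T}. \<forall>x y v. continuous_on {0..1} (\<lambda>s. A t (x + s *\<^sub>R y) v)"
    and A_bounded:
      "\<exists>a1 \<in> Lp q 0 T. \<exists>c1\<ge>0. AE t in lebesgue_on {0..T}.
         \<forall>x. norm (A t x) \<le> a1 t + c1 * norm x powr (p - 1)"
    and A_coercive:
      "\<exists>c2>0. AE t in lebesgue_on {0..T}. \<forall>x. c2 * norm x powr p \<le> A t x x"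
begin

text \<open>
  \<open>C([0,T],H)\<close>; restricting to extensional functions means that a path is determined by its
  values on \<open>[0,T]\<close>.
\<close>

definition paths :: "(real \<Rightarrow> 'h) set" where
  "paths = {x. x \<in> extensional {0..T} \<and> continuous_on {0..T} x}"

definition const_path :: "'h \<Rightarrow> real \<Rightarrow> 'h" where
  "const_path a = restrict (\<lambda>_. a) {0..T}"

definition sup_dist :: "(real \<Rightarrow> 'h) \<Rightarrow> (real \<Rightarrow> 'h) \<Rightarrow> real" where
  "sup_dist x y = (SUP r\<in>{0..T}. norm (x r - y r))"

definition d_infty :: "real \<times> (real \<Rightarrow> 'h) \<Rightarrow> real \<times> (real \<Rightarrow> 'h) \<Rightarrow> real" where
  "d_infty = (\<lambda>(t, x) (s, y).
     \<bar>t - s\<bar> + (SUP r\<in>{0..T}. norm (x (min r t) - y (min r s))))"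

definition d_infty2 :: "real \<times> (real \<Rightarrow> 'h) \<times> (real \<Rightarrow> 'h) \<Rightarrow>
    real \<times> (real \<Rightarrow> 'h) \<times> (real \<Rightarrow> 'h) \<Rightarrow> real" where
  "d_infty2 = (\<lambda>(t, x, y) (s, x', y').
     \<bar>t - s\<bar> +
     (SUP r\<in>{0..T}. norm ((x (min r t), y (min r t)) - (x' (min r s), y' (min r s)))))"

text \<open>The inclusion of \<open>H\<close> into the dual of \<open>V\<close>: \<open>H_to_dual a v = a \<bullet> j v\<close>.\<close>

definition H_to_dual :: "'h \<Rightarrow> ('v \<Rightarrow>\<^sub>L real)" where
  "H_to_dual a = blinfun_inner_right a o\<^sub>L j"

text \<open>
  \<open>Wpq t\<^sub>0 X X'\<close>: \<open>X\<close> belongs to \<open>W\<^sub>p\<^sub>q(t\<^sub>0,T)\<close> and has the generalized derivative \<open>X'\<close>. The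
  defining identity, between two elements of the dual of \<open>V\<close>, is written as equality of their
  values at each \<open>v\<close>, and evaluation at \<open>v\<close> is taken under the integral.
\<close>

definition Wpq :: "real \<Rightarrow> (real \<Rightarrow> 'v) \<Rightarrow> (real \<Rightarrow> ('v \<Rightarrow>\<^sub>L real)) \<Rightarrow> bool" where
  "Wpq t0 X X' \<longleftrightarrow> X \<in> Lp p t0 T \<and> X' \<in> Lp q t0 T \<and>
     (\<forall>\<eta> \<in> smooth_compact_support t0 T. \<forall>v.
        (\<integral>t. deriv \<eta> t * H_to_dual (j (X t)) v \<partial>lebesgue_on {t0<..<T}) =
        - (\<integral>t. \<eta> t * X' t v \<partial>lebesgue_on {t0<..<T}))"

definition is_forcing :: "real \<Rightarrow> real \<Rightarrow> (real \<Rightarrow> 'h) \<Rightarrow> (real \<Rightarrow> 'h) \<Rightarrow> bool" where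
  "is_forcing L t0 x f \<longleftrightarrow> f \<in> Lp 2 t0 T \<and>
     (\<exists>X X'. Wpq t0 X X' \<and>
        (AE t in lebesgue_on {t0<..<T}. x t = j (X t)) \<and>
        (AE t in lebesgue_on {t0<..<T}. X' t + A t (X t) = H_to_dual (f t))) \<and>
     (AE t in lebesgue_on {t0<..<T}. norm (f t) \<le> L * (1 + (SUP s\<in>{0..t}. norm (x s))))"

definition trajectories :: "real \<Rightarrow> real \<Rightarrow> (real \<Rightarrow> 'h) \<Rightarrow> (real \<Rightarrow> 'h) set" where
  "trajectories L t0 x0 =
     {x \<in> paths. (\<forall>s\<in>{0..t0}. x s = x0 s) \<and> (\<exists>f. is_forcing L t0 x f)}"

text \<open>
  The function \<open>f\<^sup>x\<close> of a trajectory \<open>x\<close>. It is unique up to null sets, so neither the choice nor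
  \<open>L\<close> matters.
\<close>

definition forcing :: "real \<Rightarrow> real \<Rightarrow> (real \<Rightarrow> 'h) \<Rightarrow> real \<Rightarrow> 'h" where
  "forcing L t0 x = (SOME f. is_forcing L t0 x f)"

definition Omega :: "real \<Rightarrow> 'h \<Rightarrow> (real \<Rightarrow> 'h) set" where
  "Omega L a = trajectories L 0 (const_path a)"

text \<open>
  \<open>C11V t\<^sub>* \<phi> \<phi>t \<phi>x \<phi>y\<close>: \<open>\<phi>\<close> is a test function on \<open>[t\<^sub>*,T]\<close> with path derivatives \<open>\<phi>t\<close>, \<open>\<phi>x\<close>,
  \<open>\<phi>y\<close>. The existence of the integral in the chain rule is stated explicitly, since the library's
  integral of a non-integrable function is \<open>0\<close>.
\<close>

definition C11V :: "real \<Rightarrow>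
    (real \<Rightarrow> (real \<Rightarrow> 'h) \<Rightarrow> (real \<Rightarrow> 'h) \<Rightarrow> real) \<Rightarrow>
    (real \<Rightarrow> (real \<Rightarrow> 'h) \<Rightarrow> (real \<Rightarrow> 'h) \<Rightarrow> real) \<Rightarrow>
    (real \<Rightarrow> (real \<Rightarrow> 'h) \<Rightarrow> (real \<Rightarrow> 'h) \<Rightarrow> 'h) \<Rightarrow>
    (real \<Rightarrow> (real \<Rightarrow> 'h) \<Rightarrow> (real \<Rightarrow> 'h) \<Rightarrow> 'h) \<Rightarrow> bool" where
  "C11V tstar \<phi> \<phi>t \<phi>x \<phi>y \<longleftrightarrow>
     continuous_wrt d_infty2 ({tstar..T} \<times> paths \<times> paths) (\<lambda>(t, x, y). \<phi> t x y) \<and>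
     continuous_wrt d_infty2 ({tstar..T} \<times> paths \<times> paths) (\<lambda>(t, x, y). \<phi>t t x y) \<and>
     continuous_wrt d_infty2 ({tstar..T} \<times> paths \<times> paths) (\<lambda>(t, x, y). \<phi>x t x y) \<and>
     continuous_wrt d_infty2 ({tstar..T} \<times> paths \<times> paths) (\<lambda>(t, x, y). \<phi>y t x y) \<and>
     (\<forall>x\<in>paths. \<forall>y\<in>paths. AE t in lebesgue_on {tstar<..<T}.
        (x t \<in> range (blinfun_apply j) \<longrightarrow> \<phi>x t x y \<in> range (blinfun_apply j)) \<and>
        (y t \<in> range (blinfun_apply j) \<longrightarrow> \<phi>y t x y \<in> range (blinfun_apply j))) \<and>
     (\<forall>t0\<in>{tstar..<T}. \<forall>x0\<in>paths. \<forall>y0\<in>paths. \<forall>x\<in>paths. \<forall>y\<in>paths. \<forall>X X' Y Y'.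
        Wpq t0 X X' \<and> Wpq t0 Y Y' \<and>
        (\<forall>s\<in>{0..t0}. x s = x0 s) \<and> (\<forall>s\<in>{0..t0}. y s = y0 s) \<and>
        (AE t in lebesgue_on {t0<..<T}. x t = j (X t)) \<and>
        (AE t in lebesgue_on {t0<..<T}. y t = j (Y t)) \<longrightarrow>
        (\<forall>t\<in>{t0..T}.
           integrable (lebesgue_on {t0..t})
             (\<lambda>s. \<phi>t s x y + X' s (inv j (\<phi>x s x y)) + Y' s (inv j (\<phi>y s x y))) \<and>
           \<phi> t x y - \<phi> t0 x0 y0 =
             (\<integral>s. \<phi>t s x y + X' s (inv j (\<phi>x s x y)) + Y' s (inv j (\<phi>y s x y))
                \<partial>lebesgue_on {t0..t})))"

text \<open>
  \<open>touches_from_above L \<Omega> w t\<^sub>0 x\<^sub>0 y\<^sub>0 \<phi>\<close> is the extremality condition defining the test functions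
  at \<open>(t\<^sub>0,x\<^sub>0,y\<^sub>0)\<close>. As \<open>w\<close> is a function on \<open>[0,T] \<times> \<Omega> \<times> \<Omega>\<close>, the infimum extends over those
  trajectories that lie in \<open>\<Omega>\<close>.
\<close>

definition touches_from_above :: "real \<Rightarrow> (real \<Rightarrow> 'h) set \<Rightarrow>
    (real \<Rightarrow> (real \<Rightarrow> 'h) \<Rightarrow> (real \<Rightarrow> 'h) \<Rightarrow> real) \<Rightarrow> real \<Rightarrow> (real \<Rightarrow> 'h) \<Rightarrow> (real \<Rightarrow> 'h) \<Rightarrow>
    (real \<Rightarrow> (real \<Rightarrow> 'h) \<Rightarrow> (real \<Rightarrow> 'h) \<Rightarrow> real) \<Rightarrow> bool" where
  "touches_from_above L \<Omega> w t0 x0 y0 \<phi> \<longleftrightarrow>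
     (\<exists>T0\<in>{t0<..T}.
        \<phi> t0 x0 y0 - w t0 x0 y0 = 0 \<and>
        (INF (t, x, y) \<in> {t0..T0} \<times> (trajectories L t0 x0 \<inter> \<Omega>) \<times> (trajectories L t0 y0 \<inter> \<Omega>).
           ereal (\<phi> t x y - w t x y)) = 0)"

end

locale terminal_value_problem = evolution_setting T p q j A
  for T p q :: real
    and j :: "'v::{banach, second_countable_topology} \<Rightarrow>\<^sub>L
              'h::{real_inner, banach, second_countable_topology}"
    and A :: "real \<Rightarrow> 'v \<Rightarrow> ('v \<Rightarrow>\<^sub>L real)" +
  fixes h :: "(real \<Rightarrow> 'h) \<Rightarrow> real"
    and F :: "real \<Rightarrow> (real \<Rightarrow> 'h) \<Rightarrow> 'h \<Rightarrow> real"
  assumes h_continuous: "continuous_wrt sup_dist paths h"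
    and F_continuous:
      "continuous_wrt (\<lambda>(t, x, z) (s, y, z'). d_infty (t, x) (s, y) + norm (z - z'))
         ({0..T} \<times> paths \<times> UNIV) (\<lambda>(t, x, z). F t x z)"
    and F_lipschitz:
      "\<exists>L0\<ge>0. \<forall>t\<in>{0..T}. \<forall>x\<in>paths. \<forall>z z'.
         \<bar>F t x z - F t x z'\<bar> \<le> L0 * (1 + (SUP s\<in>{0..t}. norm (x s))) * norm (z - z')"
    and F_modulus:
      "\<And>L t0 x0. 0 \<le> L \<Longrightarrow> t0 \<in> {0..<T} \<Longrightarrow> x0 \<in> paths \<Longrightarrow>
         \<exists>m. modulus_of_continuity m \<and>
           (\<forall>\<epsilon>>0. \<forall>t\<in>{t0..T}. \<forall>x\<in>trajectories L t0 x0. \<forall>y\<in>trajectories L t0 x0.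
              F t x (inverse \<epsilon> *\<^sub>R (x t - y t)) - F t y (inverse \<epsilon> *\<^sub>R (x t - y t))
              \<le> m (inverse \<epsilon> * (norm (x t - y t))\<^sup>2 + (SUP s\<in>{0..t}. norm (x s - y s))))"
begin

definition minimax_subsolution ::
    "real \<Rightarrow> (real \<Rightarrow> 'h) set \<Rightarrow> (real \<Rightarrow> (real \<Rightarrow> 'h) \<Rightarrow> real) \<Rightarrow> bool" where
  "minimax_subsolution L \<Omega> u \<longleftrightarrow>
     usc_wrt d_infty ({0..T} \<times> \<Omega>) (\<lambda>(t, x). u t x) \<and>
     (\<forall>x\<in>\<Omega>. u T x \<le> h x) \<and>
     (\<forall>t0\<in>{0..<T}. \<forall>x0\<in>\<Omega>. \<forall>z. \<exists>x \<in> trajectories L t0 x0 \<inter> \<Omega>. \<forall>t\<in>{t0..T}.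
        u t0 x0 \<le>
          (\<integral>s. (- forcing L t0 x s) \<bullet> z + F s x z \<partial>lebesgue_on {t0..t}) + u t x)"

definition minimax_supersolution ::
    "real \<Rightarrow> (real \<Rightarrow> 'h) set \<Rightarrow> (real \<Rightarrow> (real \<Rightarrow> 'h) \<Rightarrow> real) \<Rightarrow> bool" where
  "minimax_supersolution L \<Omega> u \<longleftrightarrow>
     lsc_wrt d_infty ({0..T} \<times> \<Omega>) (\<lambda>(t, x). u t x) \<and>
     (\<forall>x\<in>\<Omega>. u T x \<ge> h x) \<and>
     (\<forall>t0\<in>{0..<T}. \<forall>x0\<in>\<Omega>. \<forall>z. \<exists>x \<in> trajectories L t0 x0 \<inter> \<Omega>. \<forall>t\<in>{t0..T}.
        u t0 x0 \<ge>
          (\<integral>s. (- forcing L t0 x s) \<bullet> z + F s x z \<partial>lebesgue_on {t0..t}) + u t x)"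

text \<open>
  Viscosity subsolutions of the doubled equation. Non-anticipation of \<open>w\<close> is implied by upper
  semicontinuity, since \<open>d_infty2\<close> only sees stopped paths. The integrand is the
  pairing with \<open>A\<close> along the \<open>V\<close>-valued versions \<open>inv j (x t)\<close>, \<open>inv j (y t)\<close> of the trajectories,
  and the limes superior is taken in the extended reals.
\<close>

definition viscosity_subsolution_doubled ::
    "real \<Rightarrow> (real \<Rightarrow> 'h) set \<Rightarrow> (real \<Rightarrow> (real \<Rightarrow> 'h) \<Rightarrow> (real \<Rightarrow> 'h) \<Rightarrow> real) \<Rightarrow> bool" where
  "viscosity_subsolution_doubled L \<Omega> w \<longleftrightarrow>
     usc_wrt d_infty2 ({0..T} \<times> \<Omega> \<times> \<Omega>) (\<lambda>(t, x, y). w t x y) \<and>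
     (\<forall>t0\<in>{0..<T}. \<forall>x0\<in>\<Omega>. \<forall>y0\<in>\<Omega>. \<forall>\<phi> \<phi>t \<phi>x \<phi>y.
        C11V t0 \<phi> \<phi>t \<phi>x \<phi>y \<and> touches_from_above L \<Omega> w t0 x0 y0 \<phi> \<longrightarrow>
        (\<exists>x \<in> trajectories L t0 x0. \<exists>y \<in> trajectories L t0 y0.
           ereal (\<phi>t t0 x0 y0) +
           Limsup (at_right 0) (\<lambda>\<delta>. ereal (1 / \<delta> *
             (\<integral>t. - A t (inv j (x t)) (inv j (\<phi>x t x y)) - A t (inv j (y t)) (inv j (\<phi>y t x y))
                \<partial>lebesgue_on {t0..t0 + \<delta>}))) +
           ereal (F t0 x0 (\<phi>x t0 x0 y0) - F t0 y0 (- \<phi>y t0 x0 y0)) \<ge> 0))"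

end

end

theory Submission
  imports Defs
begin

text \<open>
  Apply the minimax inequalities with the frozen directions \<open>z = \<phi>x t0 x0 y0\<close> for \<open>u\<close> and
  \<open>z = - \<phi>y t0 x0 y0\<close> for \<open>v\<close>, and add them. Since \<open>\<phi> - w\<close> is minimal at \<open>(t0, x0, y0)\<close>, the
  increment of \<open>w\<close> along the two trajectories is at most that of \<open>\<phi>\<close>, which the chain rule and
  the equation express by forcings and pairings with \<open>A\<close>. The forcings only occur multiplied by
  \<open>\<phi>x s x y - \<phi>x t0 x0 y0\<close> and \<open>\<phi>y s x y - \<phi>y t0 x0 y0\<close>; they are bounded, so these terms vanish
  on average as \<open>s\<close> decreases to \<open>t0\<close>.
\<close>

section \<open>Null sets, integrability and averages on real intervals\<close>

text \<open>Only endpoints are added, and these form a null set. The evolution equation and the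
  bound on forcings are stated on open intervals, whereas the minimax inequalities and the chain
  rule integrate over closed ones.\<close>

lemma AE_lebesgue_on_Ioo_imp_Icc:
  fixes a b t :: real
  assumes "AE s in lebesgue_on {a<..<b}. P s" and "t \<le> b"
  shows "AE s in lebesgue_on {a..t}. P s"
proof -
  have "AE s in lebesgue. s \<in> {a<..<b} \<longrightarrow> P s"
    using assms(1) by (subst (asm) AE_restrict_space_iff) auto
  moreover have "AE s in lebesgue. s \<noteq> a" "AE s in lebesgue. s \<noteq> b"
    by (intro AE_completion AE_lborel_singleton)+
  ultimately have "AE s in lebesgue. s \<in> {a..t} \<longrightarrow> P s"
    by eventually_elim (use assms(2) in auto)
  then show ?thesis
    by (subst AE_restrict_space_iff) auto
qed

lemma integrable_lebesgue_on_iff: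
  fixes f :: "real \<Rightarrow> real"
  assumes "S \<in> sets lebesgue"
  shows "integrable (lebesgue_on S) f \<longleftrightarrow> f absolutely_integrable_on S"
  using assms by (simp add: integrable_restrict_space set_integrable_def)

text \<open>Measurability of \<open>g\<close> is part of the conclusion and comes from completeness
  of Lebesgue measure. This later yields integrability of the pairing with \<open>A\<close> along a
  test function.\<close>

lemma integrable_lebesgue_on_AE_cong:
  fixes f g :: "real \<Rightarrow> real"
  assumes "integrable (lebesgue_on {a..b}) f" and "AE s in lebesgue_on {a..b}. g s = f s"
  shows "integrable (lebesgue_on {a..b}) g"
proof -
  have "AE s in lebesgue. s \<in> {a..b} \<longrightarrow> g s = f s"
    using assms(2) by (subst (asm) AE_restrict_space_iff) auto
  then obtain N where N: "N \<in> null_sets lebesgue" "{s. \<not> (s \<in> {a..b} \<longrightarrow> g s = f s)} \<subseteq> N"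
    unfolding eventually_ae_filter by auto
  have "g absolutely_integrable_on {a..b}"
  proof (rule absolutely_integrable_spike)
    show "f absolutely_integrable_on {a..b}"
      using assms(1) by (simp add: integrable_lebesgue_on_iff)
    show "negligible N" using N(1) by (simp add: negligible_iff_null_sets)
    show "g s = f s" if "s \<in> {a..b} - N" for s using that N(2) by auto
  qed
  then show ?thesis by (simp add: integrable_lebesgue_on_iff)
qed

lemma integrable_bounded_inner_continuous:
  fixes f c :: "real \<Rightarrow> 'h::{real_inner, banach, second_countable_topology}"
  assumes f: "f \<in> borel_measurable (lebesgue_on {a<..<b})"
    and bound: "AE s in lebesgue_on {a<..<b}. norm (f s) \<le> M"
    and c: "continuous_on {a..b} c" and t: "t \<le> b"
  shows "integrable (lebesgue_on {a..t}) (\<lambda>s. f s \<bullet> c s)"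
proof -
  obtain K where K: "\<And>s. s \<in> {a..b} \<Longrightarrow> norm (c s) \<le> K"
    using compact_continuous_image[OF c compact_Icc]
    by (meson bounded_iff compact_imp_bounded image_eqI)
  have "c \<in> borel_measurable (lebesgue_on {a<..<b})"
    using c by (intro continuous_imp_measurable_on_sets_lebesgue)
      (auto intro: continuous_on_subset)
  then have m: "(\<lambda>s. f s \<bullet> c s) \<in> borel_measurable (lebesgue_on {a<..<b})"
    using f by measurable
  interpret finite_measure "lebesgue_on {a<..<b}"
    by (intro finite_measure_lebesgue_on bounded_set_imp_lmeasurable) auto
  have "AE s in lebesgue_on {a<..<b}. norm (f s \<bullet> c s) \<le> M * K"
  proof (rule AE_mp[OF bound], rule AE_I2, rule impI)
    fix s assume s: "s \<in> space (lebesgue_on {a<..<b})" "norm (f s) \<le> M"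
    have "norm (f s \<bullet> c s) \<le> norm (f s) * norm (c s)"
      by (simp add: Cauchy_Schwarz_ineq2)
    also have "\<dots> \<le> M * K"
      using s K[of s] by (intro mult_mono) (auto intro: order_trans[OF norm_ge_zero])
    finally show "norm (f s \<bullet> c s) \<le> M * K" .
  qed
  then have "integrable (lebesgue_on {a<..<b}) (\<lambda>s. f s \<bullet> c s)"
    using m by (rule integrable_const_bound)
  \<comment> \<open>The set-integral formulation allows adding the endpoints and then restricting to
    \<open>{a..t}\<close>.\<close>
  then have "(\<lambda>s. f s \<bullet> c s) absolutely_integrable_on {a<..<b}"
    by (simp add: integrable_lebesgue_on_iff)
  then have "(\<lambda>s. f s \<bullet> c s) absolutely_integrable_on {a..b}"
    by (simp add: absolutely_integrable_on_Icc_iff_Ioo)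
  then have "(\<lambda>s. f s \<bullet> c s) absolutely_integrable_on {a..t}"
    by (rule set_integrable_subset) (use t in auto)
  then show ?thesis by (simp add: integrable_lebesgue_on_iff)
qed

text \<open>On short intervals starting at \<open>a\<close> the average of \<open>R\<close> is at
  most \<open>c + e\<close>, so that of \<open>P\<close> is at least \<open>- c - e\<close>. No
  regularity of \<open>P\<close> beyond integrability enters, which suits the pairing with
  \<open>A\<close>; the bound on \<open>R\<close> holds only almost everywhere since
  \<open>R\<close> will contain forcings.\<close>

lemma Limsup_average_nonneg:
  fixes P R :: "real \<Rightarrow> real"
  assumes ab: "a < b"
    and P: "\<And>t. t \<in> {a..b} \<Longrightarrow> integrable (lebesgue_on {a..t}) P"
    and R: "\<And>t. t \<in> {a..b} \<Longrightarrow> integrable (lebesgue_on {a..t}) R"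
    and nonneg: "\<And>t. t \<in> {a..b} \<Longrightarrow> 0 \<le> (\<integral>s. P s + R s \<partial>lebesgue_on {a..t})"
    and R_le: "\<And>e. 0 < e \<Longrightarrow> \<exists>d>0. \<forall>t\<in>{a..a + d}. AE s in lebesgue_on {a..t}. R s \<le> c + e"
  shows "ereal (- c) \<le> Limsup (at_right 0) (\<lambda>\<delta>. ereal (1 / \<delta> * (\<integral>s. P s \<partial>lebesgue_on {a..a + \<delta>})))"
proof (rule ereal_le_epsilon2)
  fix e :: real assume "0 < e"
  obtain d where d: "d > 0" "\<And>t. t \<in> {a..a + d} \<Longrightarrow> AE s in lebesgue_on {a..t}. R s \<le> c + e"
    using R_le[OF \<open>0 < e\<close>] by blast
  \<comment> \<open>The bound holds for every small \<delta>, not just along a sequence; it passes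
    to the upper limit because \<open>at_right 0\<close> is a nontrivial filter.\<close>
  have ev: "eventually (\<lambda>\<delta>. ereal (- c - e) \<le> ereal (1 / \<delta> * (\<integral>s. P s \<partial>lebesgue_on {a..a + \<delta>}))) (at_right 0)"
    unfolding eventually_at_right_field
  proof (intro exI[of _ "min d (b - a)"] conjI allI impI)
    show "0 < min d (b - a)" using d(1) ab by simp
    fix \<delta> :: real assume \<delta>: "0 < \<delta>" "\<delta> < min d (b - a)"
    then have t: "a + \<delta> \<in> {a..b}" "a + \<delta> \<in> {a..a + d}" by auto
    let ?M = "lebesgue_on {a..a + \<delta>}"
    have cint: "integrable ?M (\<lambda>s. c + e)" and ceq: "(\<integral>s. c + e \<partial>?M) = \<delta> * (c + e)"
      using \<delta>(1) by (auto simp: measure_restrict_space)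
    have "0 \<le> (\<integral>s. P s \<partial>?M) + (\<integral>s. R s \<partial>?M)"
      using nonneg[OF t(1)] P[OF t(1)] R[OF t(1)] by simp
    also have "(\<integral>s. R s \<partial>?M) \<le> \<delta> * (c + e)"
      using integral_mono_AE[OF R[OF t(1)] cint d(2)[OF t(2)]] unfolding ceq .
    finally have "- c - e \<le> 1 / \<delta> * (\<integral>s. P s \<partial>?M)"
      using \<delta>(1) by (simp add: field_simps)
    then show "ereal (- c - e) \<le> ereal (1 / \<delta> * (\<integral>s. P s \<partial>?M))" by simp
  qed
  have "ereal (- c - e) \<le> Limsup (at_right 0) (\<lambda>\<delta>. ereal (1 / \<delta> * (\<integral>s. P s \<partial>lebesgue_on {a..a + \<delta>})))"
    by (rule le_Limsup[OF trivial_limit_at_right_real ev])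
  then have "ereal (- c - e) + ereal e \<le> Limsup (at_right 0) (\<lambda>\<delta>. ereal (1 / \<delta> * (\<integral>s. P s \<partial>lebesgue_on {a..a + \<delta>}))) + ereal e"
    by (rule add_right_mono)
  then show "ereal (- c) \<le> Limsup (at_right 0) (\<lambda>\<delta>. ereal (1 / \<delta> * (\<integral>s. P s \<partial>lebesgue_on {a..a + \<delta>}))) + ereal e"
    by simp
qed

section \<open>Stopped paths and the pseudo-metrics\<close>

context evolution_setting
begin

text \<open>Paths are bounded on the compact interval, and stopped times stay in it. Such bounds are
  required to compare the real-valued suprema in the pseudo-metrics.\<close>

lemma bdd_above_stopped_paths:
  assumes "x \<in> paths" "x' \<in> paths" "t \<in> {0..T}" "s \<in> {0..T}"
  shows "bdd_above ((\<lambda>r. norm (x (min r t) - x' (min r s))) ` {0..T})"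
proof -
  have "bounded (x ` {0..T})" "bounded (x' ` {0..T})"
    using assms(1,2) unfolding paths_def
    by (auto intro!: compact_imp_bounded compact_continuous_image)
  then obtain B B' where "\<And>r. r \<in> {0..T} \<Longrightarrow> norm (x r) \<le> B" "\<And>r. r \<in> {0..T} \<Longrightarrow> norm (x' r) \<le> B'"
    unfolding bounded_iff by blast
  then have "norm (x (min r t) - x' (min r s)) \<le> B + B'" if "r \<in> {0..T}" for r
    using that assms(3,4)
    by (intro order_trans[OF norm_triangle_ineq4] add_mono) (auto simp: min_def)
  then show ?thesis by (rule bdd_aboveI2)
qed

lemma bdd_above_stopped_pairs:
  assumes "x \<in> paths" "x' \<in> paths" "y \<in> paths" "y' \<in> paths" "t \<in> {0..T}" "s \<in> {0..T}"
  shows "bdd_above ((\<lambda>r. norm ((x (min r t), y (min r t)) - (x' (min r s), y' (min r s)))) ` {0..T})"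
proof -
  obtain B where "\<And>r. r \<in> {0..T} \<Longrightarrow> norm (x (min r t) - x' (min r s)) \<le> B"
    using bdd_above_stopped_paths[OF assms(1,2,5,6)] by (fastforce simp: bdd_above_def)
  moreover obtain B' where "\<And>r. r \<in> {0..T} \<Longrightarrow> norm (y (min r t) - y' (min r s)) \<le> B'"
    using bdd_above_stopped_paths[OF assms(3,4,5,6)] by (fastforce simp: bdd_above_def)
  ultimately have "norm ((x (min r t), y (min r t)) - (x' (min r s), y' (min r s))) \<le> B + B'"
    if "r \<in> {0..T}" for r
    using that by (auto intro: order_trans[OF norm_Pair_le] add_mono)
  then show ?thesis by (rule bdd_aboveI2)
qed

text \<open>Each component of a pair has norm at most that of the pair. Hence (semi-)continuity in
  one path carries over to functions of two paths.\<close>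

lemma d_infty_le_d_infty2:
  assumes "x \<in> paths" "x' \<in> paths" "y \<in> paths" "y' \<in> paths" "t \<in> {0..T}" "s \<in> {0..T}"
  shows "d_infty (t, x) (s, x') \<le> d_infty2 (t, x, y) (s, x', y')"
    and "d_infty (t, y) (s, y') \<le> d_infty2 (t, x, y) (s, x', y')"
proof -
  note bdd = bdd_above_stopped_pairs[OF assms]
  have ne: "{0..T} \<noteq> {}" using T_pos by simp
  have "(SUP r\<in>{0..T}. norm (x (min r t) - x' (min r s))) \<le>
      (SUP r\<in>{0..T}. norm ((x (min r t), y (min r t)) - (x' (min r s), y' (min r s))))"
    by (rule cSUP_mono[OF ne bdd], rule bexI, unfold diff_Pair, rule norm_fst_le)
  then show "d_infty (t, x) (s, x') \<le> d_infty2 (t, x, y) (s, x', y')"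
    unfolding d_infty_def d_infty2_def by simp
  have "(SUP r\<in>{0..T}. norm (y (min r t) - y' (min r s))) \<le>
      (SUP r\<in>{0..T}. norm ((x (min r t), y (min r t)) - (x' (min r s), y' (min r s))))"
    by (rule cSUP_mono[OF ne bdd], rule bexI, unfold diff_Pair, rule norm_snd_le)
  then show "d_infty (t, y) (s, y') \<le> d_infty2 (t, x, y) (s, x', y')"
    unfolding d_infty_def d_infty2_def by simp
qed

lemma d_infty2_small:
  assumes "x \<in> paths" "y \<in> paths" "0 < e"
  obtains d where "0 < d" "\<And>t s. t \<in> {0..T} \<Longrightarrow> s \<in> {0..T} \<Longrightarrow> \<bar>s - t\<bar> < d \<Longrightarrow>
      d_infty2 (t, x, y) (s, x, y) < e"
proof -
  have "uniformly_continuous_on {0..T} (\<lambda>r. (x r, y r))"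
    using assms(1,2) unfolding paths_def
    by (intro compact_uniformly_continuous continuous_on_Pair) auto
  then obtain d where d: "d > 0"
      "\<And>r r'. r \<in> {0..T} \<Longrightarrow> r' \<in> {0..T} \<Longrightarrow> dist r' r < d \<Longrightarrow> dist (x r', y r') (x r, y r) < e / 3"
    using assms(3) unfolding uniformly_continuous_on_def by (metis divide_pos_pos zero_less_numeral)
  show ?thesis
  proof (rule that[of "min d (e / 3)"])
    show "0 < min d (e / 3)" using d(1) assms(3) by simp
    fix t s assume ts: "t \<in> {0..T}" "s \<in> {0..T}" "\<bar>s - t\<bar> < min d (e / 3)"
    have "(SUP r\<in>{0..T}. norm ((x (min r t), y (min r t)) - (x (min r s), y (min r s)))) \<le> e / 3"
    proof (rule cSUP_least)
      show "{0..T} \<noteq> {}" using T_pos by simp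
      fix r assume "r \<in> {0..T}"
      then have "dist (x (min r t), y (min r t)) (x (min r s), y (min r s)) < e / 3"
        \<comment> \<open>Stopping is nonexpansive: \<open>min r t\<close> and
          \<open>min r s\<close> differ by at most \<open>\<bar>s - t\<bar>\<close>, for every
          \<open>r\<close>.\<close>
        using ts by (intro d(2)) (auto simp: dist_real_def)
      then show "norm ((x (min r t), y (min r t)) - (x (min r s), y (min r s))) \<le> e / 3"
        unfolding dist_norm by simp
    qed
    then show "d_infty2 (t, x, y) (s, x, y) < e"
      using ts(3) assms(3) unfolding d_infty2_def by (simp add: abs_minus_commute)
  qed
qed

text \<open>With the pair of paths fixed, nearby times are close in \<open>d_infty2\<close> by
  uniform continuity of the paths.\<close>

lemma continuous_on_along_paths:
  assumes g: "continuous_wrt d_infty2 ({t0..T} \<times> paths \<times> paths) (\<lambda>(t, x, y). g t x y)"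
    and "0 \<le> t0" "x \<in> paths" "y \<in> paths"
  shows "continuous_on {t0..T} (\<lambda>s. g s x y)"
  unfolding continuous_on_iff
proof (intro ballI allI impI)
  fix t e :: real assume t: "t \<in> {t0..T}" and "0 < e"
  obtain \<delta> where \<delta>: "\<delta> > 0"
      "\<And>s. s \<in> {t0..T} \<Longrightarrow> d_infty2 (t, x, y) (s, x, y) < \<delta> \<Longrightarrow> dist (g s x y) (g t x y) < e"
    using g t \<open>0 < e\<close> assms(3,4) unfolding continuous_wrt_def by fastforce
  obtain d where "0 < d" "\<And>t s. t \<in> {0..T} \<Longrightarrow> s \<in> {0..T} \<Longrightarrow> \<bar>s - t\<bar> < d \<Longrightarrow>
      d_infty2 (t, x, y) (s, x, y) < \<delta>"
    using d_infty2_small[OF assms(3,4) \<delta>(1)] by blast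
  then show "\<exists>d>0. \<forall>s\<in>{t0..T}. dist s t < d \<longrightarrow> dist (g s x y) (g t x y) < e"
    using \<delta>(2) t \<open>0 \<le> t0\<close> by (intro exI[of _ d]) (auto simp: dist_real_def)
qed

text \<open>The two points have pseudo-distance 0, since stopping at \<open>t0\<close> evaluates the
  paths only on \<open>{0..t0}\<close>. Taking the supposed positive distance of the values as
  tolerance makes it smaller than itself.\<close>

lemma continuous_wrt_nonanticipating:
  assumes g: "continuous_wrt d_infty2 ({t0..T} \<times> paths \<times> paths) (\<lambda>(t, x, y). g t x y)"
    and "t0 \<in> {0..T}" "x0 \<in> paths" "y0 \<in> paths" "x \<in> paths" "y \<in> paths"
    and eq: "\<And>s. s \<in> {0..t0} \<Longrightarrow> x s = x0 s" "\<And>s. s \<in> {0..t0} \<Longrightarrow> y s = y0 s"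
  shows "g t0 x y = g t0 x0 y0"
proof (rule ccontr)
  assume "g t0 x y \<noteq> g t0 x0 y0"
  then have "0 < dist (g t0 x y) (g t0 x0 y0)" by simp
  then obtain \<delta> where "\<delta> > 0" and \<delta>: "\<forall>b\<in>{t0..T} \<times> paths \<times> paths.
      d_infty2 (t0, x0, y0) b < \<delta> \<longrightarrow>
        dist (case b of (t, x, y) \<Rightarrow> g t x y) (g t0 x0 y0) < dist (g t0 x y) (g t0 x0 y0)"
    using g[unfolded continuous_wrt_def, THEN bspec[of _ _ "(t0, x0, y0)"],
        THEN spec[of _ "dist (g t0 x y) (g t0 x0 y0)"], THEN mp] assms(2-4) by auto
  moreover have "(SUP r\<in>{0..T}. norm ((x0 (min r t0), y0 (min r t0)) - (x (min r t0), y (min r t0)))) =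
      (SUP r\<in>{0..T}. 0)"
    using assms(2) by (intro SUP_cong) (auto simp: eq zero_prod_def)
  then have "d_infty2 (t0, x0, y0) (t0, x, y) = 0"
    using T_pos unfolding d_infty2_def by simp
  ultimately show False
    using bspec[OF \<delta>, of "(t0, x, y)"] assms(2,5,6) by simp
qed

section \<open>Forcings of trajectories and the chain rule\<close>

lemma trajectory_forcing:
  assumes "x \<in> trajectories L t0 x0"
  shows "x \<in> paths" "\<And>s. s \<in> {0..t0} \<Longrightarrow> x s = x0 s" "is_forcing L t0 x (forcing L t0 x)"
proof -
  have "x \<in> paths \<and> (\<forall>s\<in>{0..t0}. x s = x0 s) \<and> (\<exists>f. is_forcing L t0 x f)"
    using assms unfolding trajectories_def by blast
  then show "x \<in> paths" "\<And>s. s \<in> {0..t0} \<Longrightarrow> x s = x0 s" "is_forcing L t0 x (forcing L t0 x)"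
    unfolding forcing_def by (simp_all add: someI_ex)
qed

text \<open>A bound \<open>B\<close> for the path on \<open>{0..T}\<close> turns the linear growth
  condition into the constant bound \<open>L * (1 + B)\<close>.\<close>

lemma forcing_bounded:
  assumes "x \<in> paths" "is_forcing L t0 x f" "0 \<le> L" "0 \<le> t0"
  obtains M where "0 \<le> M" "AE s in lebesgue_on {t0<..<T}. norm (f s) \<le> M"
proof -
  have "bounded (x ` {0..T})"
    using assms(1) unfolding paths_def by (auto intro!: compact_imp_bounded compact_continuous_image)
  then obtain B where B: "\<And>r. r \<in> {0..T} \<Longrightarrow> norm (x r) \<le> B"
    unfolding bounded_iff by blast
  have "AE s in lebesgue_on {t0<..<T}. norm (f s) \<le> L * (1 + (SUP r\<in>{0..s}. norm (x r)))"
    using assms(2) unfolding is_forcing_def by blast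
  then have "AE s in lebesgue_on {t0<..<T}. norm (f s) \<le> L * (1 + B)"
  proof (rule lebesgue_on_mono)
    fix s assume *: "norm (f s) \<le> L * (1 + (SUP r\<in>{0..s}. norm (x r)))" and s: "s \<in> {t0<..<T}"
    have "(SUP r\<in>{0..s}. norm (x r)) \<le> B"
      using s assms(4) by (intro cSUP_least B) auto
    then show "norm (f s) \<le> L * (1 + B)"
      using * assms(3) by (meson add_left_mono mult_left_mono order_trans)
  qed
  moreover have "0 \<le> B" using B[of 0] T_pos by (auto intro: order_trans[OF norm_ge_zero])
  then have "0 \<le> L * (1 + B)" using assms(3) by simp
  ultimately show ?thesis using that by blast
qed

lemma forcing_inner_integrable:
  assumes "x \<in> paths" "is_forcing L t0 x f" "0 \<le> L" "0 \<le> t0"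
    and "continuous_on {t0..T} c" "t \<le> T"
  shows "integrable (lebesgue_on {t0..t}) (\<lambda>s. f s \<bullet> c s)"
proof -
  obtain M where "AE s in lebesgue_on {t0<..<T}. norm (f s) \<le> M"
    using forcing_bounded[OF assms(1-4)] by blast
  moreover have "f \<in> borel_measurable (lebesgue_on {t0<..<T})"
    using assms(2) unfolding is_forcing_def Lp_def by blast
  ultimately show ?thesis
    using assms(5,6) by (intro integrable_bounded_inner_continuous)
qed

lemma forcing_inner_small:
  assumes "x \<in> paths" "is_forcing L t0 x f" "0 \<le> L" "t0 \<in> {0..<T}"
    and c: "continuous_on {t0..T} c" "c t0 = 0" and "0 < e"
  shows "\<exists>d>0. \<forall>t\<in>{t0..t0 + d}. AE s in lebesgue_on {t0..t}. f s \<bullet> c s \<le> e"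
proof -
  obtain M where M: "0 \<le> M" "AE s in lebesgue_on {t0<..<T}. norm (f s) \<le> M"
    using forcing_bounded[OF assms(1-3)] assms(4) by auto
  \<comment> \<open>The shift by 1 keeps the denominator positive when \<open>M = 0\<close>.\<close>
  have "0 < e / (M + 1)" using M(1) \<open>0 < e\<close> by simp
  then obtain d where d: "0 < d" "\<And>s. s \<in> {t0..T} \<Longrightarrow> dist s t0 < d \<Longrightarrow> norm (c s) < e / (M + 1)"
    using c(1)[unfolded continuous_on_iff, THEN bspec, of t0] assms(4) c(2) by auto
  \<comment> \<open>Half of \<open>d\<close> keeps the closed interval inside the strict
    neighbourhood; \<open>T - t0\<close> keeps it within the time horizon.\<close>
  define d' where "d' = min (d / 2) (T - t0)"
  have "AE s in lebesgue_on {t0..t}. f s \<bullet> c s \<le> e" if t: "t \<in> {t0..t0 + d'}" for t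
  proof (rule lebesgue_on_mono)
    show "AE s in lebesgue_on {t0..t}. norm (f s) \<le> M"
      using M(2) by (rule AE_lebesgue_on_Ioo_imp_Icc) (use t in \<open>auto simp: d'_def\<close>)
    fix s assume s: "norm (f s) \<le> M" "s \<in> {t0..t}"
    have "f s \<bullet> c s \<le> norm (f s) * norm (c s)" by (rule norm_cauchy_schwarz)
    also have "\<dots> \<le> (M + 1) * (e / (M + 1))"
      using s t M(1) d by (intro mult_mono less_imp_le[OF d(2)]) (auto simp: d'_def dist_real_def)
    also have "\<dots> = e" using M(1) by simp
    finally show "f s \<bullet> c s \<le> e" .
  qed
  moreover have "0 < d'" using d(1) assms(4) by (simp add: d'_def)
  ultimately show ?thesis by blast
qed

text \<open>The evolution equation is tested with the element \<open>inv j (c s)\<close> of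
  \<open>V\<close>. It really represents \<open>c s\<close>, because \<open>x s = j (X s)\<close>
  lies in the range of \<open>j\<close> almost everywhere. The pairing of the forcing then becomes
  an inner product in \<open>H\<close>.\<close>

lemma forcing_pairing:
  assumes "Wpq t0 X X'" "AE s in lebesgue_on {t0<..<T}. x s = j (X s)"
    and "AE s in lebesgue_on {t0<..<T}. X' s + A s (X s) = H_to_dual (f s)"
    and "AE s in lebesgue_on {t0<..<T}. x s \<in> range (blinfun_apply j) \<longrightarrow> c s \<in> range (blinfun_apply j)"
  shows "AE s in lebesgue_on {t0<..<T}. X' s (inv j (c s)) = f s \<bullet> c s - A s (inv j (x s)) (inv j (c s))"
  using assms(2-4)
proof eventually_elim
  case (elim s)
  have X: "inv j (x s) = X s" using elim(1) inj_embedding by simp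
  have c: "j (inv j (c s)) = c s" using elim(1,3) by (simp add: f_inv_into_f)
  have "X' s (inv j (c s)) + A s (X s) (inv j (c s)) = H_to_dual (f s) (inv j (c s))"
    using elim(2) by (metis plus_blinfun.rep_eq)
  also have "\<dots> = f s \<bullet> c s" by (simp add: H_to_dual_def c inner_commute)
  finally show ?case by (simp add: X)
qed

text \<open>The generalized derivatives in the chain rule are replaced by forcings and pairings with
  \<open>A\<close>. Integrability of \<open>P\<close> follows by difference: \<open>C11V\<close>
  grants that of the whole integrand, and the other terms are continuous or bounded forcings paired
  with continuous functions.\<close>

lemma test_function_chain_rule:
  assumes C: "C11V t0 \<phi> \<phi>t \<phi>x \<phi>y" and t0: "t0 \<in> {0..<T}" and L: "0 \<le> L"
    and x0: "x0 \<in> paths" and y0: "y0 \<in> paths"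
    and x: "x \<in> trajectories L t0 x0" and y: "y \<in> trajectories L t0 y0" and t: "t \<in> {t0..T}"
  defines "f \<equiv> forcing L t0 x" and "g \<equiv> forcing L t0 y"
    and "P \<equiv> \<lambda>s. - A s (inv j (x s)) (inv j (\<phi>x s x y)) - A s (inv j (y s)) (inv j (\<phi>y s x y))"
  shows "integrable (lebesgue_on {t0..t}) P"
    and "\<phi> t x y - \<phi> t0 x0 y0 =
      (\<integral>s. P s + (\<phi>t s x y + f s \<bullet> \<phi>x s x y + g s \<bullet> \<phi>y s x y) \<partial>lebesgue_on {t0..t})"
proof -
  note xt = trajectory_forcing[OF x, folded f_def] and yt = trajectory_forcing[OF y, folded g_def]
  obtain X X' where X: "Wpq t0 X X'" "AE s in lebesgue_on {t0<..<T}. x s = j (X s)"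
      "AE s in lebesgue_on {t0<..<T}. X' s + A s (X s) = H_to_dual (f s)"
    using xt(3) unfolding is_forcing_def by blast
  obtain Y Y' where Y: "Wpq t0 Y Y'" "AE s in lebesgue_on {t0<..<T}. y s = j (Y s)"
      "AE s in lebesgue_on {t0<..<T}. Y' s + A s (Y s) = H_to_dual (g s)"
    using yt(3) unfolding is_forcing_def by blast
  let ?I = "\<lambda>s. \<phi>t s x y + X' s (inv j (\<phi>x s x y)) + Y' s (inv j (\<phi>y s x y))"
  have chain: "integrable (lebesgue_on {t0..t}) ?I"
    "\<phi> t x y - \<phi> t0 x0 y0 = (\<integral>s. ?I s \<partial>lebesgue_on {t0..t})"
    \<comment> \<open>This selects the last conjunct, the chain rule, at the \<open>V\<close>-valued
      representatives \<open>X\<close>, \<open>Y\<close> and their derivatives.\<close>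
    using C[unfolded C11V_def, THEN conjunct2, THEN conjunct2, THEN conjunct2, THEN conjunct2,
        THEN conjunct2, THEN bspec, of t0, THEN bspec, OF _ x0, THEN bspec, OF _ y0,
        THEN bspec, OF _ xt(1), THEN bspec, OF _ yt(1), THEN spec[of _ X], THEN spec[of _ X'],
        THEN spec[of _ Y], THEN spec[of _ Y'], THEN mp, THEN bspec, OF _ _ t]
      t0 xt(2) yt(2) X(1,2) Y(1,2) by auto
  have V: "AE s in lebesgue_on {t0<..<T}. x s \<in> range (blinfun_apply j) \<longrightarrow> \<phi>x s x y \<in> range (blinfun_apply j)"
      "AE s in lebesgue_on {t0<..<T}. y s \<in> range (blinfun_apply j) \<longrightarrow> \<phi>y s x y \<in> range (blinfun_apply j)"
    using C xt(1) yt(1) unfolding C11V_def by auto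
  let ?J = "\<lambda>s. \<phi>t s x y + f s \<bullet> \<phi>x s x y + g s \<bullet> \<phi>y s x y"
  have "AE s in lebesgue_on {t0<..<T}. ?I s = P s + ?J s"
    using forcing_pairing[OF X V(1)] forcing_pairing[OF Y V(2)]
    by eventually_elim (simp add: P_def)
  then have eq: "AE s in lebesgue_on {t0..t}. ?I s = P s + ?J s"
    using t by (intro AE_lebesgue_on_Ioo_imp_Icc) auto
  have cont: "continuous_on {t0..T} (\<lambda>s. \<phi>t s x y)" "continuous_on {t0..T} (\<lambda>s. \<phi>x s x y)"
      "continuous_on {t0..T} (\<lambda>s. \<phi>y s x y)"
    using C t0 xt(1) yt(1) unfolding C11V_def by (auto intro: continuous_on_along_paths)
  have "integrable (lebesgue_on {t0..t}) ?J"
    using t t0 L cont xt yt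
    by (intro Bochner_Integration.integrable_add forcing_inner_integrable continuous_imp_integrable_real)
      (auto intro: continuous_on_subset)
  moreover from this have "integrable (lebesgue_on {t0..t}) (\<lambda>s. ?I s - ?J s)"
    using chain(1) by (rule Bochner_Integration.integrable_diff[rotated])
  then show P: "integrable (lebesgue_on {t0..t}) P"
    by (rule integrable_lebesgue_on_AE_cong) (use eq in eventually_elim, simp)
  ultimately have "(\<integral>s. ?I s \<partial>lebesgue_on {t0..t}) = (\<integral>s. P s + ?J s \<partial>lebesgue_on {t0..t})"
    using chain(1) eq by (intro integral_cong_AE) auto
  then show "\<phi> t x y - \<phi> t0 x0 y0 = (\<integral>s. P s + ?J s \<partial>lebesgue_on {t0..t})"
    using chain(2) by simp
qed

end

section \<open>Minimax semisolutions and the doubled equation\<close>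

context terminal_value_problem
begin

text \<open>With \<open>z\<close> frozen, \<open>F\<close> is viewed as a function of a pair that
  ignores the second path, so the facts on time continuity and non-anticipation for pairs apply to
  it.\<close>

lemma F_continuous_wrt_d_infty2:
  "0 \<le> t0 \<Longrightarrow> continuous_wrt d_infty2 ({t0..T} \<times> paths \<times> paths) (\<lambda>(t, x, y). F t x z)"
  unfolding continuous_wrt_def
proof (intro ballI allI impI)
  fix a and e :: real
  assume "0 \<le> t0" and a: "a \<in> {t0..T} \<times> paths \<times> paths" and "0 < e"
  obtain t x y where txy1: "a = (t, x, y)" by (cases a)
  with a \<open>0 \<le> t0\<close> have txy: "a = (t, x, y)" "t \<in> {0..T}" "x \<in> paths" "y \<in> paths"
    by simp_all
  from txy obtain \<delta> where \<delta>: "\<delta> > 0" "\<And>s x'. s \<in> {0..T} \<Longrightarrow> x' \<in> paths \<Longrightarrow>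
      d_infty (t, x) (s, x') < \<delta> \<Longrightarrow> dist (F s x' z) (F t x z) < e"
    using F_continuous[unfolded continuous_wrt_def, rule_format, OF _ \<open>0 < e\<close>, of "(t, x, z)"]
    by fastforce
  have "dist (F s x' z) (F t x z) < e"
    if "s \<in> {t0..T}" "x' \<in> paths" "y' \<in> paths" "d_infty2 a (s, x', y') < \<delta>" for s x' y'
    using that txy \<open>0 \<le> t0\<close> d_infty_le_d_infty2(1)[of x x' y y' t s] by (intro \<delta>(2)) auto
  then show "\<exists>\<delta>>0. \<forall>b\<in>{t0..T} \<times> paths \<times> paths. d_infty2 a b < \<delta> \<longrightarrow>
      dist (case b of (t, x, y) \<Rightarrow> F t x z) (case a of (t, x, y) \<Rightarrow> F t x z) < e"
    using \<delta>(1) txy(1) by (intro exI[of _ \<delta>]) auto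
qed

lemma usc_doubled:
  assumes u: "usc_wrt d_infty ({0..T} \<times> \<Omega>) (\<lambda>(t, x). u t x)"
    and v: "lsc_wrt d_infty ({0..T} \<times> \<Omega>) (\<lambda>(t, x). v t x)" and "\<Omega> \<subseteq> paths"
  shows "usc_wrt d_infty2 ({0..T} \<times> \<Omega> \<times> \<Omega>) (\<lambda>(t, x, y). u t x - v t y)"
  unfolding usc_wrt_def
proof (intro ballI allI impI, clarsimp)
  fix t x y and e :: real
  assume *: "0 < e" "0 \<le> t" "t \<le> T" "x \<in> \<Omega>" "y \<in> \<Omega>"
  then have e: "0 < e / 2" by simp
  obtain \<delta> where \<delta>: "\<delta> > 0" "\<And>s x'. s \<in> {0..T} \<Longrightarrow> x' \<in> \<Omega> \<Longrightarrow>
      d_infty (t, x) (s, x') < \<delta> \<Longrightarrow> u s x' < u t x + e / 2"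
    using u[unfolded usc_wrt_def, rule_format, OF _ e, of "(t, x)"] * by fastforce
  obtain \<eta> where \<eta>: "\<eta> > 0" "\<And>s y'. s \<in> {0..T} \<Longrightarrow> y' \<in> \<Omega> \<Longrightarrow>
      d_infty (t, y) (s, y') < \<eta> \<Longrightarrow> v t y - e / 2 < v s y'"
    using v[unfolded lsc_wrt_def, rule_format, OF _ e, of "(t, y)"] * by fastforce
  show "\<exists>\<delta>>0. \<forall>s\<in>{0..T}. \<forall>x'\<in>\<Omega>. \<forall>y'\<in>\<Omega>.
      d_infty2 (t, x, y) (s, x', y') < \<delta> \<longrightarrow> u s x' - v s y' < u t x - v t y + e"
  proof (intro exI[of _ "min \<delta> \<eta>"] conjI ballI impI)
    show "0 < min \<delta> \<eta>" using \<delta> \<eta> by simp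
    fix s x' y' assume s: "s \<in> {0..T}" "x' \<in> \<Omega>" "y' \<in> \<Omega>" "d_infty2 (t, x, y) (s, x', y') < min \<delta> \<eta>"
    have "x \<in> paths" "x' \<in> paths" "y \<in> paths" "y' \<in> paths" "t \<in> {0..T}" "s \<in> {0..T}"
      using s * assms(3) by auto
    note d = d_infty_le_d_infty2[OF this]
    have "u s x' < u t x + e / 2" using s d(1) by (intro \<delta>(2)) auto
    moreover have "v t y - e / 2 < v s y'" using s d(2) by (intro \<eta>(2)) auto
    ultimately show "u s x' - v s y' < u t x - v t y + e" by argo
  qed
qed

text \<open>The minimax trajectories themselves are the witnesses. Each satisfies its inequality for
  all \<open>t\<close> at once, so the averages over shrinking intervals run along one fixed
  pair.\<close>

lemma minimax_imp_viscosity_doubled: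
  assumes L: "0 \<le> L" and \<Omega>: "\<Omega> \<subseteq> paths"
    and u: "minimax_subsolution L \<Omega> u" and v: "minimax_supersolution L \<Omega> v"
  shows "viscosity_subsolution_doubled L \<Omega> (\<lambda>t x y. u t x - v t y)"
  unfolding viscosity_subsolution_doubled_def
proof (intro conjI ballI allI impI)
  show "usc_wrt d_infty2 ({0..T} \<times> \<Omega> \<times> \<Omega>) (\<lambda>(t, x, y). u t x - v t y)"
    using u v \<Omega> unfolding minimax_subsolution_def minimax_supersolution_def by (blast intro: usc_doubled)
  fix t0 x0 y0 \<phi> \<phi>t \<phi>x \<phi>y
  assume t0: "t0 \<in> {0..<T}" and x0: "x0 \<in> \<Omega>" and y0: "y0 \<in> \<Omega>"
    and "C11V t0 \<phi> \<phi>t \<phi>x \<phi>y \<and> touches_from_above L \<Omega> (\<lambda>t x y. u t x - v t y) t0 x0 y0 \<phi>"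
  then have C: "C11V t0 \<phi> \<phi>t \<phi>x \<phi>y"
    and touch: "touches_from_above L \<Omega> (\<lambda>t x y. u t x - v t y) t0 x0 y0 \<phi>" by auto
  have p0: "x0 \<in> paths" "y0 \<in> paths" using x0 y0 \<Omega> by auto
  define zx where "zx = \<phi>x t0 x0 y0"
  define zy where "zy = \<phi>y t0 x0 y0"
  obtain x where x: "x \<in> trajectories L t0 x0" "x \<in> \<Omega>" and ux: "\<And>t. t \<in> {t0..T} \<Longrightarrow>
      u t0 x0 \<le> (\<integral>s. (- forcing L t0 x s) \<bullet> zx + F s x zx \<partial>lebesgue_on {t0..t}) + u t x"
    using u t0 x0 unfolding minimax_subsolution_def by blast
  \<comment> \<open>The direction \<open>- zy\<close> matches the last argument of \<open>F\<close>
    in the doubled equation and turns the forcing term into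
    \<open>+ g s \<bullet> zy\<close>.\<close>
  obtain y where y: "y \<in> trajectories L t0 y0" "y \<in> \<Omega>" and vy: "\<And>t. t \<in> {t0..T} \<Longrightarrow>
      (\<integral>s. (- forcing L t0 y s) \<bullet> (- zy) + F s y (- zy) \<partial>lebesgue_on {t0..t}) + v t y \<le> v t0 y0"
    using v t0 y0 unfolding minimax_supersolution_def by blast
  define f where "f = forcing L t0 x"
  define g where "g = forcing L t0 y"
  note xt = trajectory_forcing[OF x(1), folded f_def] and yt = trajectory_forcing[OF y(1), folded g_def]
  let ?P = "\<lambda>s. - A s (inv j (x s)) (inv j (\<phi>x s x y)) - A s (inv j (y s)) (inv j (\<phi>y s x y))"
  let ?G = "\<lambda>s. \<phi>t s x y + F s x zx - F s y (- zy)"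
  define R where "R = (\<lambda>s. ?G s + f s \<bullet> (\<phi>x s x y - zx) + g s \<bullet> (\<phi>y s x y - zy))"
  define c where "c = \<phi>t t0 x0 y0 + F t0 x0 zx - F t0 y0 (- zy)"
  have nonneg0: "0 \<le> t0" "t0 \<in> {0..T}" using t0 by auto
  note C' = C[unfolded C11V_def]
  note cont = continuous_on_along_paths[OF _ nonneg0(1) xt(1) yt(1)]
    continuous_on_along_paths[OF F_continuous_wrt_d_infty2 nonneg0(1), OF nonneg0(1)]
  note nonant = continuous_wrt_nonanticipating[OF _ nonneg0(2) p0 xt(1) yt(1) xt(2) yt(2)]
  have c\<phi>: "continuous_on {t0..T} (\<lambda>s. \<phi>t s x y)" "continuous_on {t0..T} (\<lambda>s. \<phi>x s x y)"
      "continuous_on {t0..T} (\<lambda>s. \<phi>y s x y)"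
    using C' by (auto intro: cont(1))
  have cF: "continuous_on {t0..T} (\<lambda>s. F s x zx)" "continuous_on {t0..T} (\<lambda>s. F s y (- zy))"
    using cont(2) xt(1) yt(1) by auto
  \<comment> \<open>The trajectories share the past of \<open>x0\<close> and \<open>y0\<close>, so
    non-anticipation identifies the values at \<open>t0\<close>.\<close>
  have at0: "\<phi>t t0 x y = \<phi>t t0 x0 y0" "\<phi>x t0 x y = zx" "\<phi>y t0 x y = zy"
    using C' unfolding zx_def zy_def by (auto intro: nonant)
  have F0: "F t0 x zx = F t0 x0 zx" "F t0 y (- zy) = F t0 y0 (- zy)"
    using continuous_wrt_nonanticipating[OF F_continuous_wrt_d_infty2 nonneg0(2), OF nonneg0(1)]
      xt(1,2) yt(1,2) p0 by blast+
  have intF: "integrable (lebesgue_on {t0..t}) (\<lambda>s. F s x zx)"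
      "integrable (lebesgue_on {t0..t}) (\<lambda>s. F s y (- zy))"
      "integrable (lebesgue_on {t0..t}) (\<lambda>s. \<phi>t s x y)"
    if "t \<in> {t0..T}" for t
    using that c\<phi> cF
    by (auto intro!: continuous_imp_integrable_real intro: continuous_on_subset)
  have intf: "integrable (lebesgue_on {t0..t}) (\<lambda>s. f s \<bullet> zx)"
      "integrable (lebesgue_on {t0..t}) (\<lambda>s. g s \<bullet> zy)"
      "integrable (lebesgue_on {t0..t}) (\<lambda>s. f s \<bullet> \<phi>x s x y)"
      "integrable (lebesgue_on {t0..t}) (\<lambda>s. g s \<bullet> \<phi>y s x y)"
    if "t \<in> {t0..T}" for t
    using that c\<phi> nonneg0 L xt(1,3) yt(1,3)
    by (auto intro!: forcing_inner_integrable[OF xt(1,3)] forcing_inner_integrable[OF yt(1,3)])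
  have R_int: "integrable (lebesgue_on {t0..t}) R" if "t \<in> {t0..T}" for t
    unfolding R_def inner_diff_right using intF[OF that] intf[OF that] by auto
  obtain T0 where T0: "t0 < T0" "T0 \<le> T" "\<phi> t0 x0 y0 = u t0 x0 - v t0 y0"
    and INF0: "(INF (t, x, y) \<in> {t0..T0} \<times> (trajectories L t0 x0 \<inter> \<Omega>) \<times> (trajectories L t0 y0 \<inter> \<Omega>).
           ereal (\<phi> t x y - (u t x - v t y))) = 0"
    using touch unfolding touches_from_above_def by auto
  have main: "0 \<le> (\<integral>s. ?P s + R s \<partial>lebesgue_on {t0..t})" if t: "t \<in> {t0..T0}" for t
  proof -
    have tT: "t \<in> {t0..T}" using t T0 by auto
    let ?M = "lebesgue_on {t0..t}"
    note chain = test_function_chain_rule[OF C t0 L p0 x(1) y(1) tT, folded f_def g_def]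
    \<comment> \<open>The pair is admissible in the infimum because the minimax trajectories lie in
      \<Omega>.\<close>
    have "0 \<le> ereal (\<phi> t x y - (u t x - v t y))"
      unfolding INF0[symmetric] using t x y by (intro INF_lower2[of "(t, x, y)"]) auto
    then have "u t x - v t y \<le> \<phi> t x y" by simp
    moreover have "u t0 x0 - u t x \<le> (\<integral>s. F s x zx \<partial>?M) - (\<integral>s. f s \<bullet> zx \<partial>?M)"
      using ux[OF tT] intF[OF tT] intf[OF tT] by (simp add: f_def)
    moreover have "(\<integral>s. F s y (- zy) \<partial>?M) + (\<integral>s. g s \<bullet> zy \<partial>?M) \<le> v t0 y0 - v t y"
      using vy[OF tT] intF[OF tT] intf[OF tT] by (simp add: g_def)
    moreover have "(\<integral>s. ?P s + R s \<partial>?M) = (\<phi> t x y - \<phi> t0 x0 y0) +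
        (\<integral>s. F s x zx \<partial>?M) - (\<integral>s. f s \<bullet> zx \<partial>?M) - ((\<integral>s. F s y (- zy) \<partial>?M) + (\<integral>s. g s \<bullet> zy \<partial>?M))"
      unfolding chain(2) R_def inner_diff_right
      using chain(1) intF[OF tT] intf[OF tT] by simp
    \<comment> \<open>\<open>\<phi> - w\<close> is zero at \<open>t0\<close> and nonnegative at
      \<open>t\<close>, so the increment of \<phi> dominates that of \<open>u - v\<close>.\<close>
    ultimately show ?thesis using T0(3) by linarith
  qed
  have "ereal (- c) \<le> Limsup (at_right 0) (\<lambda>\<delta>. ereal (1 / \<delta> * (\<integral>s. ?P s \<partial>lebesgue_on {t0..t0 + \<delta>})))"
  proof (rule Limsup_average_nonneg[OF T0(1)])
    show "integrable (lebesgue_on {t0..t}) ?P" if "t \<in> {t0..T0}" for t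
      using that T0 by (intro test_function_chain_rule(1)[OF C t0 L p0 x(1) y(1)]) auto
    show "integrable (lebesgue_on {t0..t}) R" if "t \<in> {t0..T0}" for t
      using that T0 by (intro R_int) auto
    show "0 \<le> (\<integral>s. ?P s + R s \<partial>lebesgue_on {t0..t})" if "t \<in> {t0..T0}" for t
      by (rule main[OF that])
    fix e :: real assume "0 < e"
    \<comment> \<open>One third each for the continuous part \<open>?G\<close> and the two forcing
      terms of \<open>R\<close>.\<close>
    then have e: "0 < e / 3" by simp
    have "continuous_on {t0..T} ?G" by (intro continuous_intros c\<phi> cF)
    moreover have G0: "?G t0 = c" by (simp add: at0 F0 c_def)
    ultimately obtain d1 where d1: "0 < d1" "\<And>s. s \<in> {t0..T} \<Longrightarrow> dist s t0 < d1 \<Longrightarrow> dist (?G s) c < e / 3"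
      using e t0 unfolding continuous_on_iff by (metis atLeastAtMost_iff atLeastLessThan_iff less_imp_le order_refl)
    have "continuous_on {t0..T} (\<lambda>s. \<phi>x s x y - zx)"
      by (intro continuous_on_diff continuous_on_const c\<phi>)
    from forcing_inner_small[OF xt(1,3) L t0 this _ e]
    obtain d2 where d2: "0 < d2" "\<And>t. t \<in> {t0..t0 + d2} \<Longrightarrow>
        AE s in lebesgue_on {t0..t}. f s \<bullet> (\<phi>x s x y - zx) \<le> e / 3"
      using at0 by auto
    have "continuous_on {t0..T} (\<lambda>s. \<phi>y s x y - zy)"
      by (intro continuous_on_diff continuous_on_const c\<phi>)
    from forcing_inner_small[OF yt(1,3) L t0 this _ e]
    obtain d3 where d3: "0 < d3" "\<And>t. t \<in> {t0..t0 + d3} \<Longrightarrow>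
        AE s in lebesgue_on {t0..t}. g s \<bullet> (\<phi>y s x y - zy) \<le> e / 3"
      using at0 by auto
    \<comment> \<open>Halving \<open>d1\<close> gives the strict inequality demanded by the
      continuity estimate even at the right endpoint.\<close>
    define d where "d = Min {d1 / 2, d2, d3, T - t0}"
    have "0 < d" using d1 d2 d3 t0 by (simp add: d_def)
    moreover have "AE s in lebesgue_on {t0..t}. R s \<le> c + e" if t: "t \<in> {t0..t0 + d}" for t
    proof -
      have t': "t \<in> {t0..t0 + d2}" "t \<in> {t0..t0 + d3}" "t \<le> T" "t < t0 + d1"
        using t d1(1) by (auto simp: d_def)
      have "AE s in lebesgue_on {t0..t}. f s \<bullet> (\<phi>x s x y - zx) \<le> e / 3 \<and> g s \<bullet> (\<phi>y s x y - zy) \<le> e / 3"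
        using d2(2)[OF t'(1)] d3(2)[OF t'(2)] by eventually_elim simp
      then show ?thesis
      proof (rule lebesgue_on_mono)
        fix s assume s: "f s \<bullet> (\<phi>x s x y - zx) \<le> e / 3 \<and> g s \<bullet> (\<phi>y s x y - zy) \<le> e / 3" "s \<in> {t0..t}"
        then have "dist (?G s) c < e / 3" using t' by (intro d1(2)) (auto simp: dist_real_def)
        then have "?G s \<le> c + e / 3" unfolding dist_real_def by linarith
        then show "R s \<le> c + e" using s(1) unfolding R_def by linarith
      qed
    qed
    ultimately show "\<exists>d>0. \<forall>t\<in>{t0..t0 + d}. AE s in lebesgue_on {t0..t}. R s \<le> c + e" by blast
  qed
  then have "0 \<le> ereal (\<phi>t t0 x0 y0) +
      Limsup (at_right 0) (\<lambda>\<delta>. ereal (1 / \<delta> * (\<integral>s. ?P s \<partial>lebesgue_on {t0..t0 + \<delta>}))) +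
      ereal (F t0 x0 zx - F t0 y0 (- zy))"
    unfolding c_def
    \<comment> \<open>The upper limit may be infinite: the lower bound \<open>- c\<close> excludes
      minus infinity, and plus infinity satisfies the inequality.\<close>
    by (cases "Limsup (at_right 0) (\<lambda>\<delta>. ereal (1 / \<delta> * (\<integral>s. ?P s \<partial>lebesgue_on {t0..t0 + \<delta>})))") auto
  then show "\<exists>x\<in>trajectories L t0 x0. \<exists>y\<in>trajectories L t0 y0.
      0 \<le> ereal (\<phi>t t0 x0 y0) +
        Limsup (at_right 0) (\<lambda>\<delta>. ereal (1 / \<delta> *
          (\<integral>t. - A t (inv j (x t)) (inv j (\<phi>x t x y)) - A t (inv j (y t)) (inv j (\<phi>y t x y))
             \<partial>lebesgue_on {t0..t0 + \<delta>}))) +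
        ereal (F t0 x0 (\<phi>x t0 x0 y0) - F t0 y0 (- \<phi>y t0 x0 y0))"
    using x(1) y(1) unfolding zx_def zy_def by blast
qed

end

theorem theorem4p3:
  fixes T p q L :: real
    and j :: "'v::{banach, second_countable_topology} \<Rightarrow>\<^sub>L
              'h::{real_inner, banach, second_countable_topology}"
    and A :: "real \<Rightarrow> 'v \<Rightarrow> ('v \<Rightarrow>\<^sub>L real)"
    and h :: "(real \<Rightarrow> 'h) \<Rightarrow> real"
    and F :: "real \<Rightarrow> (real \<Rightarrow> 'h) \<Rightarrow> 'h \<Rightarrow> real"
    and xstar :: 'h
    and \<Omega> :: "(real \<Rightarrow> 'h) set"
    and u v :: "real \<Rightarrow> (real \<Rightarrow> 'h) \<Rightarrow> real"
  assumes "terminal_value_problem T p q j A h F"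
    and "0 \<le> L"
    and "evolution_setting.Omega T p q j A L xstar \<subseteq> \<Omega>"
    and "\<Omega> \<subseteq> evolution_setting.paths T"
    and "terminal_value_problem.minimax_subsolution T p q j A h F L \<Omega> u"
    and "terminal_value_problem.minimax_supersolution T p q j A h F L \<Omega> v"
  shows "terminal_value_problem.viscosity_subsolution_doubled T p q j A F L \<Omega>
           (\<lambda>t x y. u t x - v t y)"
  using terminal_value_problem.minimax_imp_viscosity_doubled[OF assms(1,2,4-6)] .

end
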